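(* Let $V$ be a finite set of variants partitioned into semantic classes $\mathcal{C}$, let $m:V\to[0,1]$ be a score function, let $\hat h:\mathcal{C}\to\{0,1\}$ be the audited class label map, let $h^\star:V\to\{0,1\}$ be the latent variant-level harm, and let $\mathcal{X}=\Delta(V)$ be the set of platform strategies. Let $$\hat\alpha=\min_{c\in\mathcal{C}:\,\hat h(c)=1}\ \max_{u:\mathrm{cl}(u)=c} m(u),$$ where at least one class $c$ has $\hat h(c)=1$. If $\hat\alpha>0$, then every strategy $x\in\mathcal{X}$ satisfies $$\mathsf{H}^\star(x)\le \frac{1}{\hat\alpha}\,\mathsf{M}_{\mathrm{Env}(m)}(x)+\Delta(x),$$ where $\mathsf{H}^\star(x)$ is the true harmful exposure and $\Delta(x)$ is the disagreement mass.
   Context: Variants and classes. $V$ is a finite set of content variants. A published audit protocol consists of a finite relation $T_0\subseteq V\times V$, a function $A:V\times V\to\{0,1\}$, a confidence score $s(v,u)\in[0,1]$ for each pair in $T_0$, and a threshold $\rho\in[0,1]$; its edge set is $E_\rho=\{(v,u)\in T_0: A(v,u)=1 \text{ and } s(v,u)\ge\rho\}$. The set $\mathcal{C}$ of semantic classes is the set of equivalence classes of the reflexive-symmetric-transitive closure of $E_\rho$, so $\mathcal{C}$ is a partition of $V$. Write $\mathrm{cl}(v)\in\mathcal{C}$ for the class containing $v$. Strategies. $\mathcal{X}=\Delta(V)=\{x\in\mathbb{R}_{\ge 0}^{V}:\sum_{v\in V}x_v=1\}$ is the probability simplex on $V$ (not to be confused with the disagreement mass $\Delta(x)$ of a strategy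 $x$, defined below). Metric and envelope. For a score function $g:V\to[0,1]$, $\mathsf{M}_g(x)=\sum_{v\in V}x_v g(v)$. For $m:V\to[0,1]$, $\mathrm{Env}(m)(v)=\max\{m(u): u\in V,\ \mathrm{cl}(u)=\mathrm{cl}(v)\}$. Harm quantities. The maps $\hat h:\mathcal{C}\to\{0,1\}$ and $h^\star:V\to\{0,1\}$ are arbitrary; no relation between them is assumed (in particular harm-purity of classes is not assumed). The true harmful exposure is $\mathsf{H}^\star(x)=\sum_{v\in V}x_v h^\star(v)$, and the disagreement mass is $\Delta(x)=\sum_{v\in V}x_v\,|h^\star(v)-\hat h(\mathrm{cl}(v))|$. *)

theory Defs
  imports "HOL-Analysis.Analysis"
begin

text \<open>
  Functions with domain \<open>V\<close> (or \<open>V \<times> V\<close>, or the set of classes) are total HOL functions.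
  All definitions below evaluate them on that domain only.
\<close>

record 'a protocol =
  candidates :: "('a \<times> 'a) set"
  audit :: "'a \<times> 'a \<Rightarrow> nat"
  confidence :: "'a \<times> 'a \<Rightarrow> real"
  threshold :: real

definition audit_protocol :: "'a set \<Rightarrow> 'a protocol \<Rightarrow> bool" where
  "audit_protocol V P \<longleftrightarrow>
     candidates P \<subseteq> V \<times> V \<and>
     audit P \<in> V \<times> V \<rightarrow> {0, 1} \<and>
     confidence P \<in> candidates P \<rightarrow> {0..1} \<and>
     threshold P \<in> {0..1}"

definition edges :: "'a protocol \<Rightarrow> ('a \<times> 'a) set" where
  "edges P = {e \<in> candidates P. audit P e = 1 \<and> confidence P e \<ge> threshold P}"

text \<open>
  The library closure \<open>equivclp\<close> is reflexive on the whole type, so it is restricted to \<open>V\<close>.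
\<close>

definition sem_equiv :: "'a set \<Rightarrow> 'a protocol \<Rightarrow> ('a \<times> 'a) set" where
  "sem_equiv V P = {(v, u) \<in> V \<times> V. equivclp (\<lambda>a b. (a, b) \<in> edges P) v u}"

definition classes :: "'a set \<Rightarrow> 'a protocol \<Rightarrow> 'a set set" where
  "classes V P = V // sem_equiv V P"

definition cl :: "'a set \<Rightarrow> 'a protocol \<Rightarrow> 'a \<Rightarrow> 'a set" where
  "cl V P v = sem_equiv V P `` {v}"

definition strategies :: "'a set \<Rightarrow> ('a \<Rightarrow> real) set" where
  "strategies V = {x. (\<forall>v\<in>V. 0 \<le> x v) \<and> (\<Sum>v\<in>V. x v) = 1}"

definition platform_metric :: "'a set \<Rightarrow> ('a \<Rightarrow> real) \<Rightarrow> ('a \<Rightarrow> real) \<Rightarrow> real" where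
  "platform_metric V g x = (\<Sum>v\<in>V. x v * g v)"

definition envelope :: "'a set \<Rightarrow> 'a protocol \<Rightarrow> ('a \<Rightarrow> real) \<Rightarrow> 'a \<Rightarrow> real" where
  "envelope V P m v = Max {m u | u. u \<in> V \<and> cl V P u = cl V P v}"

definition true_harm :: "'a set \<Rightarrow> ('a \<Rightarrow> real) \<Rightarrow> ('a \<Rightarrow> real) \<Rightarrow> real" where
  "true_harm V hstar x = (\<Sum>v\<in>V. x v * hstar v)"

definition disagreement ::
  "'a set \<Rightarrow> 'a protocol \<Rightarrow> ('a set \<Rightarrow> real) \<Rightarrow> ('a \<Rightarrow> real) \<Rightarrow> ('a \<Rightarrow> real) \<Rightarrow> real" where
  "disagreement V P hhat hstar x = (\<Sum>v\<in>V. x v * \<bar>hstar v - hhat (cl V P v)\<bar>)"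

definition alpha_hat ::
  "'a set \<Rightarrow> 'a protocol \<Rightarrow> ('a set \<Rightarrow> real) \<Rightarrow> ('a \<Rightarrow> real) \<Rightarrow> real" where
  "alpha_hat V P hhat m =
     Min {Max {m u | u. u \<in> V \<and> cl V P u = c} | c. c \<in> classes V P \<and> hhat c = 1}"

lemma equiv_sem_equiv: "equiv V (sem_equiv V P)"
proof (rule equivI)
  show "sem_equiv V P \<subseteq> V \<times> V" "refl_on V (sem_equiv V P)"
    by (auto simp: sem_equiv_def refl_on_def)
  show "sym (sem_equiv V P)"
    by (auto simp: sem_equiv_def sym_def intro: equivclp_sym)
  show "trans (sem_equiv V P)"
    by (auto simp: sem_equiv_def trans_def intro: equivclp_trans)
qed

end

theory Submission
  imports Defs
begin

text \<open>
  The inequality holds variant by variant. If the class of \<open>v\<close> is labelled harmful, then the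
  envelope at \<open>v\<close> is one of the maxima over which \<open>\<alpha>\<close> is the minimum, so the first term is at least
  1. Otherwise the disagreement at \<open>v\<close> is the harm of \<open>v\<close>. Averaging with the weights \<open>x v\<close> gives
  the theorem.
\<close>

lemma cl_in_classes: "v \<in> V \<Longrightarrow> cl V P v \<in> classes V P"
  unfolding cl_def classes_def by (rule quotientI)

text \<open>Ensures that \<open>Min\<close> in \<open>alpha_hat\<close> ranges over a finite set, as
  \<open>Min_le\<close> requires.\<close>

lemma finite_classes:
  assumes "finite V"
  shows "finite (classes V P)"
  unfolding classes_def
  by (rule finite_quotient[OF assms]) (auto simp: sem_equiv_def)

text \<open>\<open>v\<close> belongs to its own class, so \<open>m v\<close> is among the values
  maximised. This is what makes the envelope nonnegative.\<close>

lemma envelope_ge: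
  assumes "finite V" and "v \<in> V"
  shows "m v \<le> envelope V P m v"
  unfolding envelope_def using assms by (intro Max_ge) auto

text \<open>Taking \<open>c = cl V P v\<close> turns the inner maximum of \<open>alpha_hat\<close>
  into the envelope at \<open>v\<close>.\<close>

lemma alpha_hat_le_envelope:
  assumes "finite V" and "v \<in> V" and "hhat (cl V P v) = 1"
  shows "alpha_hat V P hhat m \<le> envelope V P m v"
  unfolding alpha_hat_def envelope_def
  using finite_classes[OF \<open>finite V\<close>] cl_in_classes[OF \<open>v \<in> V\<close>] assms(3)
  by (intro Min_le) auto

theorem theorem3:
  fixes V :: "'a set"
    and P :: "'a protocol"
    and m :: "'a \<Rightarrow> real"
    and hhat :: "'a set \<Rightarrow> real"
    and hstar :: "'a \<Rightarrow> real"
    and x :: "'a \<Rightarrow> real"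
  assumes "finite V"
    and "audit_protocol V P"
    and "m \<in> V \<rightarrow> {0..1}"
    and "hhat \<in> classes V P \<rightarrow> {0, 1}"
    and "hstar \<in> V \<rightarrow> {0, 1}"
    and "\<exists>c\<in>classes V P. hhat c = 1"
    and "alpha_hat V P hhat m > 0"
    and "x \<in> strategies V"
  shows "true_harm V hstar x
    \<le> 1 / alpha_hat V P hhat m * platform_metric V (envelope V P m) x + disagreement V P hhat hstar x"
proof -
  let ?\<alpha> = "alpha_hat V P hhat m"
  have pointwise: "hstar v \<le> 1 / ?\<alpha> * envelope V P m v + \<bar>hstar v - hhat (cl V P v)\<bar>"
    if "v \<in> V" for v
  proof -
    have hstar: "hstar v = 0 \<or> hstar v = 1"
      using \<open>hstar \<in> V \<rightarrow> {0, 1}\<close> that by auto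
    have "hhat (cl V P v) = 0 \<or> hhat (cl V P v) = 1"
      using \<open>hhat \<in> classes V P \<rightarrow> {0, 1}\<close> cl_in_classes[OF that] by auto
    then show ?thesis
    proof
      \<comment> \<open>The disagreement term alone covers \<open>hstar v\<close> here, so it
        remains to see that the envelope term is nonnegative.\<close>
      assume "hhat (cl V P v) = 0"
      moreover have "0 \<le> m v"
        using \<open>m \<in> V \<rightarrow> {0..1}\<close> that by auto
      then have "0 \<le> envelope V P m v"
        using envelope_ge[OF \<open>finite V\<close> that] by (rule order_trans)
      then have "0 \<le> 1 / ?\<alpha> * envelope V P m v"
        using \<open>?\<alpha> > 0\<close> by simp
      ultimately show ?thesis
        by simp
    next
      assume "hhat (cl V P v) = 1"
      with \<open>finite V\<close> that have "?\<alpha> \<le> envelope V P m v"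
        by (rule alpha_hat_le_envelope)
      then have "1 \<le> 1 / ?\<alpha> * envelope V P m v"
        using \<open>?\<alpha> > 0\<close> by simp
      \<comment> \<open>Since \<open>hstar v\<close> is at most 1, the envelope term suffices and
        the absolute value only adds to it.\<close>
      then show ?thesis
        using hstar by auto
    qed
  qed
  \<comment> \<open>Nonnegative weights preserve the pointwise bound under summation; linearity then
    splits the sum into the two terms.\<close>
  have "true_harm V hstar x
      \<le> (\<Sum>v\<in>V. x v * (1 / ?\<alpha> * envelope V P m v + \<bar>hstar v - hhat (cl V P v)\<bar>))"
    unfolding true_harm_def using \<open>x \<in> strategies V\<close>
    by (intro sum_mono mult_left_mono pointwise) (auto simp: strategies_def)
  also have "\<dots> = 1 / ?\<alpha> * platform_metric V (envelope V P m) x + disagreement V P hhat hstar x"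
    by (simp add: platform_metric_def disagreement_def sum_distrib_left sum.distrib algebra_simps)
  finally show ?thesis .
qed

end
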